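(* The Friedrichs operator of the tetrablock $$\mathbb{E}=\{(x_1,x_2,x_3)\in\mathbb{C}^3 : 1-zx_1-wx_2+zwx_3\neq 0 \text{ for all } z,w\in\overline{\mathbb{D}}\}$$ is of rank one.
   Context: $\mathbb{D}$ is the open unit disc in $\mathbb{C}$ and $\overline{\mathbb{D}}$ is its closure. For a domain $D\subset\mathbb{C}^n$, the Bergman space $A^2(D)$ is the closed subspace of $L^2(D)$ (with respect to Lebesgue measure, with inner product $\langle f,g\rangle=\int_D f\bar g\,dV$) consisting of holomorphic functions. The Bergman projection $B_D$ is the orthogonal projection of $L^2(D)$ onto $A^2(D)$. The Friedrichs operator of $D$ is the (conjugate-linear) map $F_D\colon A^2(D)\to A^2(D)$, $F_D(g)=B_D(\bar g)$. It is of rank one if its range is a one-dimensional complex vector space. *)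

theory Defs
  imports "HOL-Analysis.Analysis" "HOL-Library.Function_Algebras"
begin

(* Holomorphy in several variables: the real Frechet derivative exists at every point and is
   the complex-linear functional with coefficient vector a. *)
definition holomorphic_several :: "(complex ^ 'n) set \<Rightarrow> (complex ^ 'n \<Rightarrow> complex) \<Rightarrow> bool" where
  "holomorphic_several D f \<longleftrightarrow>
     (\<forall>x\<in>D. \<exists>a :: complex ^ 'n. (f has_derivative (\<lambda>h. \<Sum>i\<in>UNIV. a $ i * h $ i)) (at x))"

(* Representatives of the classes in L^2(D). The measure lebesgue on complex ^ 'n is the ordinary
   Lebesgue measure of the underlying real space of dimension 2 * CARD('n). *)
definition L2_space :: "(complex ^ 'n) set \<Rightarrow> (complex ^ 'n \<Rightarrow> complex) set" where
  "L2_space D = {f. f \<in> borel_measurable (lebesgue_on D) \<and>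
                    integrable (lebesgue_on D) (\<lambda>x. (norm (f x))\<^sup>2)}"

definition L2_inner ::
  "(complex ^ 'n) set \<Rightarrow> (complex ^ 'n \<Rightarrow> complex) \<Rightarrow> (complex ^ 'n \<Rightarrow> complex) \<Rightarrow> complex" where
  "L2_inner D f g = (LINT x|lebesgue_on D. f x * cnj (g x))"

(* A function on D is encoded as a total function that vanishes outside D. For open D the class
   in L^2(D) of a holomorphic function then has exactly one representative in this set, so no
   quotient is needed. *)
definition bergman_space :: "(complex ^ 'n) set \<Rightarrow> (complex ^ 'n \<Rightarrow> complex) set" where
  "bergman_space D = {f \<in> L2_space D. holomorphic_several D f \<and> (\<forall>x. x \<notin> D \<longrightarrow> f x = 0)}"

(* Orthogonal projection of f in L^2(D): the unique element of the Bergman space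
   whose difference from f is orthogonal to the Bergman space. *)
definition bergman_projection ::
  "(complex ^ 'n) set \<Rightarrow> (complex ^ 'n \<Rightarrow> complex) \<Rightarrow> (complex ^ 'n \<Rightarrow> complex)" where
  "bergman_projection D f =
     (THE h. h \<in> bergman_space D \<and> (\<forall>g\<in>bergman_space D. L2_inner D (\<lambda>x. f x - h x) g = 0))"

definition friedrichs_operator ::
  "(complex ^ 'n) set \<Rightarrow> (complex ^ 'n \<Rightarrow> complex) \<Rightarrow> (complex ^ 'n \<Rightarrow> complex)" where
  "friedrichs_operator D g = bergman_projection D (\<lambda>x. cnj (g x))"

definition scale_fun :: "complex \<Rightarrow> ('a \<Rightarrow> complex) \<Rightarrow> ('a \<Rightarrow> complex)" where
  "scale_fun c f = (\<lambda>x. c * f x)"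

lemma vector_space_scale_fun: "vector_space (scale_fun :: complex \<Rightarrow> ('a \<Rightarrow> complex) \<Rightarrow> _)"
  by unfold_locales (auto simp: scale_fun_def fun_eq_iff algebra_simps)

definition friedrichs_rank_one :: "(complex ^ 'n) set \<Rightarrow> bool" where
  "friedrichs_rank_one D \<longleftrightarrow>
     module.subspace scale_fun (friedrichs_operator D ` bergman_space D) \<and>
     vector_space.dim scale_fun (friedrichs_operator D ` bergman_space D) = 1"

definition tetrablock :: "(complex ^ 3) set" where
  "tetrablock = {x. \<forall>z\<in>cball 0 1. \<forall>w\<in>cball 0 1.
                      1 - z * x $ 1 - w * x $ 2 + z * w * x $ 3 \<noteq> 0}"

end

theory Submission
  imports Defs "HOL-Complex_Analysis.Cauchy_Integral_Formula"
begin

text \<open>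
  The tetrablock is invariant under the maps \<open>(x\<^sub>1, x\<^sub>2, x\<^sub>3) \<mapsto> (t x\<^sub>1, t x\<^sub>2, t\<^sup>2 x\<^sub>3)\<close> with \<open>\<bar>t\<bar> \<le> 1\<close>,
  because replacing \<open>x\<close> by its image amounts to replacing \<open>z, w\<close> by \<open>tz, tw\<close> in the defining condition.
  This symmetry alone determines the Friedrichs operator, so the argument is carried out for every
  nonempty open set \<open>D\<close> of finite measure that is invariant under such an action with positive weights.

  For \<open>\<bar>t\<bar> = 1\<close> the action preserves Lebesgue measure. Hence the integral over \<open>D\<close> of a holomorphic
  integrable \<open>h\<close> does not change if \<open>h\<close> is averaged over the circle \<open>\<bar>t\<bar> = 1\<close>; by the mean value
  property on the disc \<open>t \<mapsto> t \<cdot> x\<close>, whose centre is the origin, that average is the constant \<open>h(0)\<close>.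
  So \<open>\<integral>\<^sub>D h = vol(D) h(0)\<close> (lemma \<open>integral_quasi_balanced\<close>). Applied to products \<open>h = (g - g(0)) f\<close>
  with \<open>f, g\<close> in the Bergman space, this says that the conjugate of \<open>g - g(0)\<close> is orthogonal to the
  Bergman space. Therefore the operator sends \<open>g\<close> to the constant with value the conjugate of \<open>g(0)\<close>
  (lemma \<open>friedrichs_operator_quasi_balanced\<close>). Constants lie in the Bergman space because \<open>D\<close> has
  finite measure, so the range is exactly the line of constants.
\<close>

section \<open>Invariance of Lebesgue measure under orthogonal maps\<close>

text \<open>
  An orthogonal map carries balls to balls of the same radius, and by Vitali's covering theorem an
  open set is, up to a null set, a countable disjoint union of balls. Only this inequality is derived
  from the covering, since equality would need the preimage of the exceptional null set to be null;
  the converse inequality comes for free by applying the lemma to the inverse map.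
\<close>

lemma emeasure_vimage_orthogonal_ge:
  fixes f :: "'a::euclidean_space \<Rightarrow> 'a"
  assumes f: "orthogonal_transformation f" and U: "open U"
  shows "emeasure lborel U \<le> emeasure lborel (f -` U)"
proof -
  define K where "K = {(a, r). 0 < r \<and> ball a r \<subseteq> U}"
  have fine: "\<exists>i. i \<in> K \<and> x \<in> ball (fst i) (snd i) \<and> snd i < d" if "x \<in> U" "0 < d" for x d
  proof -
    obtain e where "0 < e" "ball x e \<subseteq> U"
      using U \<open>x \<in> U\<close> openE by blast
    with \<open>0 < d\<close> show ?thesis
      by (intro exI[of _ "(x, min e (d/2))"]) (auto simp: K_def)
  qed
  obtain C where C: "countable C" "C \<subseteq> K"
      "pairwise (\<lambda>i j. disjnt (ball (fst i) (snd i)) (ball (fst j) (snd j))) C"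
      "negligible (U - (\<Union>i\<in>C. ball (fst i) (snd i)))"
    using Vitali_covering_theorem_balls[of U K fst snd, OF fine] by blast
  let ?W = "\<Union>i\<in>C. ball (fst i) (snd i)"
  have WU: "?W \<subseteq> U"
    using C(2) unfolding K_def by fastforce
  have fW: "f -` ball a r = ball (inv f a) r" for a r
  proof -
    have "dist a (f x) = dist (inv f a) x" for x
      using f by (metis orthogonal_transformation_isometry orthogonal_transformation_surj surj_f_inv_f)
    then show ?thesis by auto
  qed
  have [measurable]: "f \<in> borel \<rightarrow>\<^sub>M borel"
    by (intro borel_measurable_continuous_onI linear_continuous_on
        linear_conv_bounded_linear[THEN iffD1] orthogonal_transformation_linear f)
  have disj: "disjoint_family_on (\<lambda>i. ball (fst i) (snd i)) C"
    using C(3) by (auto simp: disjoint_family_on_def pairwise_def disjnt_def)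
  then have fdisj: "disjoint_family_on (\<lambda>i. f -` ball (fst i) (snd i)) C"
    unfolding disjoint_family_on_def by blast
  have Wb: "?W \<in> sets borel"
    by (intro borel_open open_UN ballI open_ball)
  have "U - ?W \<in> null_sets lborel"
    using C(4) U Wb by (subst null_sets_completion_iff[symmetric])
      (auto simp: negligible_iff_null_sets intro!: sets.Diff)
  then have "emeasure lborel U = emeasure lborel ?W"
    using emeasure_Un_null_set[of ?W lborel "U - ?W"] WU Wb by (simp add: Un_absorb1)
  also have "\<dots> = (\<integral>\<^sup>+i. emeasure lborel (ball (fst i) (snd i)) \<partial>count_space C)"
    using C(1) disj by (intro emeasure_UN_countable) auto
  also have "\<dots> = (\<integral>\<^sup>+i. emeasure lborel (f -` ball (fst i) (snd i)) \<partial>count_space C)"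
    using C(2) by (intro nn_integral_cong) (auto simp: fW emeasure_ball K_def subset_iff less_imp_le split: prod.splits)
  also have "\<dots> = emeasure lborel (\<Union>i\<in>C. f -` ball (fst i) (snd i))"
    using C(1) fdisj by (intro emeasure_UN_countable[symmetric]) (auto simp: fW)
  also have "\<dots> \<le> emeasure lborel (f -` U)"
    using WU U by (intro emeasure_mono) (auto intro!: measurable_sets_borel[of f borel])
  finally show ?thesis .
qed

lemma lborel_distr_orthogonal:
  fixes f :: "'a::euclidean_space \<Rightarrow> 'a"
  assumes f: "orthogonal_transformation f"
  shows "distr lborel borel f = lborel"
proof (rule lborel_eqI[symmetric])
  fix l u :: 'a assume le: "\<And>b. b \<in> Basis \<Longrightarrow> l \<bullet> b \<le> u \<bullet> b"
  have cont: "continuous_on UNIV f"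
    using linear_continuous_on[OF linear_conv_bounded_linear[THEN iffD1, OF orthogonal_transformation_linear[OF f]]] .
  then have [measurable]: "f \<in> borel \<rightarrow>\<^sub>M borel"
    by (rule borel_measurable_continuous_onI)
  have "inv f -` (f -` box l u) = box l u"
    using f by (auto simp: orthogonal_transformation_surj surj_f_inv_f)
  moreover have "open (f -` box l u)"
    using cont by (intro open_vimage open_box)
  ultimately have "emeasure lborel (f -` box l u) = emeasure lborel (box l u)"
    using emeasure_vimage_orthogonal_ge[OF f, of "box l u"]
      emeasure_vimage_orthogonal_ge[OF orthogonal_transformation_inv[OF f], of "f -` box l u"]
    by (simp add: order_antisym open_box)
  with le show "emeasure (distr lborel borel f) (box l u) = (\<Prod>b\<in>Basis. (u - l) \<bullet> b)"
    by (simp add: emeasure_distr)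
qed simp

lemma
  fixes f :: "'a::euclidean_space \<Rightarrow> 'a" and g :: "'a \<Rightarrow> 'b::{banach, second_countable_topology}"
  assumes f: "orthogonal_transformation f" and g: "integrable lborel g"
  shows integrable_compose_orthogonal: "integrable lborel (\<lambda>x. g (f x))"
    and integral_compose_orthogonal: "(LINT x|lborel. g (f x)) = integral\<^sup>L lborel g"
proof -
  have [measurable]: "f \<in> borel \<rightarrow>\<^sub>M borel"
    by (intro borel_measurable_continuous_onI linear_continuous_on
        linear_conv_bounded_linear[THEN iffD1] orthogonal_transformation_linear f)
  have [measurable]: "g \<in> borel_measurable borel"
    using g by auto
  show "integrable lborel (\<lambda>x. g (f x))"
    using g integrable_distr_eq[of f lborel borel g] lborel_distr_orthogonal[OF f] by simp
  show "(LINT x|lborel. g (f x)) = integral\<^sup>L lborel g"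
    using integral_distr[of f lborel borel g] lborel_distr_orthogonal[OF f] by simp
qed

section \<open>Weighted circle actions\<close>

definition weighted_scale :: "('n \<Rightarrow> nat) \<Rightarrow> complex \<Rightarrow> complex ^ 'n \<Rightarrow> complex ^ 'n" where
  "weighted_scale m t x = (\<chi> i. t ^ m i * x $ i)"

text \<open>
  Positivity of the weights makes every disc \<open>t \<mapsto> weighted_scale m t x\<close> pass through the origin
  at its centre.
\<close>
definition quasi_balanced :: "('n \<Rightarrow> nat) \<Rightarrow> (complex ^ 'n) set \<Rightarrow> bool" where
  "quasi_balanced m D \<longleftrightarrow>
     (\<forall>i. 0 < m i) \<and> (\<forall>x\<in>D. \<forall>t\<in>cball 0 1. weighted_scale m t x \<in> D)"

lemma weighted_scale_0:
  assumes "quasi_balanced m D" shows "weighted_scale m 0 x = 0"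
  using assms by (simp add: weighted_scale_def quasi_balanced_def vec_eq_iff)

lemma orthogonal_weighted_scale:
  assumes "norm t = 1"
  shows "orthogonal_transformation (weighted_scale m t :: complex ^ 'n \<Rightarrow> _)"
  unfolding orthogonal_transformation
proof (intro conjI allI)
  show "linear (weighted_scale m t :: complex ^ 'n \<Rightarrow> _)"
    by (rule linearI) (simp_all add: weighted_scale_def vec_eq_iff distrib_left)
  show "norm (weighted_scale m t x) = norm x" for x :: "complex ^ 'n"
    using assms by (simp add: weighted_scale_def norm_vec_def norm_mult norm_power)
qed

lemma weighted_scale_has_derivative:
  fixes x :: "complex ^ 'n"
  shows "((\<lambda>t. weighted_scale m t x) has_derivative
      (\<lambda>h. \<chi> i. of_nat (m i) * (h * t ^ (m i - 1)) * x $ i)) (at t)"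
proof (subst has_derivative_componentwise_within, intro ballI)
  fix b :: "complex ^ 'n" assume "b \<in> Basis"
  then obtain i u where b: "b = axis i u" by (auto simp: Basis_vec_def)
  show "((\<lambda>t. weighted_scale m t x \<bullet> b) has_derivative
      (\<lambda>h. (\<chi> i. of_nat (m i) * (h * t ^ (m i - 1)) * x $ i) \<bullet> b)) (at t)"
    unfolding b weighted_scale_def inner_axis vec_lambda_beta
    by (auto intro!: derivative_eq_intros simp: mult_ac)
qed

lemma holomorphic_on_weighted_disc:
  fixes D :: "(complex ^ 'n) set"
  assumes D: "quasi_balanced m D" and h: "holomorphic_several D h" and x: "x \<in> D"
  shows "(\<lambda>t. h (weighted_scale m t x)) holomorphic_on cball 0 1"
proof (rule holomorphic_onI)
  fix t :: complex assume "t \<in> cball 0 1"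
  with D x have "weighted_scale m t x \<in> D"
    by (auto simp: quasi_balanced_def)
  then obtain a where a: "(h has_derivative (\<lambda>v. \<Sum>i\<in>UNIV. a $ i * v $ i))
      (at (weighted_scale m t x))"
    using h by (auto simp: holomorphic_several_def)
  let ?d = "\<Sum>i\<in>UNIV. a $ i * (of_nat (m i) * t ^ (m i - 1) * x $ i)"
  have "((\<lambda>t. h (weighted_scale m t x)) has_derivative
      (\<lambda>k. \<Sum>i\<in>UNIV. a $ i * (\<chi> i. of_nat (m i) * (k * t ^ (m i - 1)) * x $ i) $ i)) (at t)"
    by (rule has_derivative_compose[OF weighted_scale_has_derivative a])
  also have "(\<lambda>k. \<Sum>i\<in>UNIV. a $ i * (\<chi> i. of_nat (m i) * (k * t ^ (m i - 1)) * x $ i) $ i)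
      = (*) ?d"
    by (simp add: fun_eq_iff sum_distrib_left mult_ac)
  finally show "(\<lambda>t. h (weighted_scale m t x)) field_differentiable at t within cball 0 1"
    by (auto simp: field_differentiable_def has_field_derivative_def
        intro: has_derivative_at_withinI)
qed

text \<open>
  Cauchy's formula on the unit circle, with the contour integral written out in the angle.
\<close>
lemma mean_value_unit_circle:
  fixes \<phi> :: "complex \<Rightarrow> complex"
  assumes "\<phi> holomorphic_on cball 0 1"
  shows "(LINT \<theta>:{0..2*pi}|lborel. \<phi> (cis \<theta>)) = 2 * pi * \<phi> 0"
proof -
  have "((\<lambda>u. \<phi> u / u) has_contour_integral (2 * of_real pi * \<i> * \<phi> 0))
      (part_circlepath 0 1 0 (2 * pi))"
    using Cauchy_integral_circlepath_simple[OF assms, of 0] by (simp add: circlepath_def)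
  then have "((\<lambda>\<theta>. \<phi> (cis \<theta>) / cis \<theta> * \<i> * cis \<theta>) has_integral 2 * of_real pi * \<i> * \<phi> 0) {0..2*pi}"
    by (subst (asm) has_contour_integral_part_circlepath_iff) auto
  \<comment> \<open>multiplying by \<open>- \<i>\<close> removes the factor \<open>\<i>\<close> of the differential \<open>du = \<i> cis \<theta> d\<theta>\<close>\<close>
  then have "((\<lambda>\<theta>. - \<i> * (\<phi> (cis \<theta>) / cis \<theta> * \<i> * cis \<theta>)) has_integral
      - \<i> * (2 * of_real pi * \<i> * \<phi> 0)) {0..2*pi}"
    by (rule has_integral_mult_right)
  then have I: "((\<lambda>\<theta>. \<phi> (cis \<theta>)) has_integral 2 * pi * \<phi> 0) {0..2*pi}"
    by (simp add: mult_ac)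
  have "continuous_on {0..2*pi} (\<lambda>\<theta>. \<phi> (cis \<theta>))"
    by (rule continuous_on_compose2[OF holomorphic_on_imp_continuous_on[OF assms]])
      (auto intro!: continuous_intros)
  then have "set_integrable lborel {0..2*pi} (\<lambda>\<theta>. \<phi> (cis \<theta>))"
    by (rule borel_integrable_atLeastAtMost')
  then show ?thesis
    using set_borel_integral_eq_integral(2)[of "{0..2*pi}" "\<lambda>\<theta>. \<phi> (cis \<theta>)"]
      integral_unique[OF I] by simp
qed


section \<open>Integrals of holomorphic functions over quasi-balanced sets\<close>

lemma holomorphic_several_imp_continuous_on:
  "holomorphic_several D h \<Longrightarrow> continuous_on D h"
  unfolding holomorphic_several_def
  by (meson continuous_at_imp_continuous_on has_derivative_continuous)

lemma borel_measurable_continuous_on_extend_0: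
  fixes h :: "'a::euclidean_space \<Rightarrow> complex"
  assumes "open D" "continuous_on D h" "\<And>x. x \<notin> D \<Longrightarrow> h x = 0"
  shows "h \<in> borel_measurable borel"
proof -
  have "(\<lambda>x. indicator D x *\<^sub>R h x) = h"
    using assms(3) by (auto simp: fun_eq_iff indicator_def)
  with borel_measurable_continuous_on_indicator[of D h] assms show ?thesis
    by auto
qed

text \<open>
  The passage to Borel measure on the whole space makes the product measure on pairs of an angle
  and a point available, and makes composition with a rotation measurable.
\<close>
lemma
  fixes h :: "'a::euclidean_space \<Rightarrow> complex"
  assumes D: "open D" and h: "h \<in> borel_measurable borel" and off: "\<And>x. x \<notin> D \<Longrightarrow> h x = 0"
  shows integrable_lebesgue_on_iff_lborel: "integrable (lebesgue_on D) h \<longleftrightarrow> integrable lborel h"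
    and integral_lebesgue_on_eq_lborel: "integral\<^sup>L (lebesgue_on D) h = integral\<^sup>L lborel h"
proof -
  have D': "D \<inter> space lebesgue \<in> sets lebesgue"
    using D by auto
  have eq: "(\<lambda>x. indicator D x *\<^sub>R h x) = h"
    using off by (auto simp: fun_eq_iff indicator_def)
  show "integrable (lebesgue_on D) h \<longleftrightarrow> integrable lborel h"
    using h by (simp add: integrable_restrict_space[OF D'] eq integrable_completion)
  show "integral\<^sup>L (lebesgue_on D) h = integral\<^sup>L lborel h"
    using h by (simp add: integral_restrict_space[OF D'] eq integral_completion)
qed

text \<open>
  The function \<open>F\<close> below is \<open>h\<close> rotated by the angle \<open>\<theta>\<close>. Integrating it first over the space gives
  the integral of \<open>h\<close> for each angle, by invariance of the measure; integrating it first over the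
  angle gives \<open>2 \<pi> h(0)\<close> at each point of \<open>D\<close>, by the mean value property.
\<close>
lemma integral_quasi_balanced:
  fixes D :: "(complex ^ 'n) set" and h :: "complex ^ 'n \<Rightarrow> complex"
  assumes D: "quasi_balanced m D" "open D" "D \<in> lmeasurable"
    and h: "holomorphic_several D h" "\<And>x. x \<notin> D \<Longrightarrow> h x = 0"
    and int: "integrable (lebesgue_on D) h"
  shows "integral\<^sup>L (lebesgue_on D) h = measure lebesgue D * h 0"
proof -
  let ?R = "\<lambda>\<theta>. weighted_scale m (cis \<theta>)"
  let ?I = "{0..2 * pi}"
  define F where "F = (\<lambda>\<theta> x. indicator ?I \<theta> *\<^sub>R h (?R \<theta> x))"
  have hm[measurable]: "h \<in> borel_measurable borel"
    by (rule borel_measurable_continuous_on_extend_0[OF D(2)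
          holomorphic_several_imp_continuous_on[OF h(1)] h(2)])
  have hint: "integrable lborel h"
    using int integrable_lebesgue_on_iff_lborel[of D h] D(2) hm h(2) by simp
  have R: "orthogonal_transformation (?R \<theta>)" for \<theta>
    by (rule orthogonal_weighted_scale) simp
  have "(\<lambda>p. ?R (fst p) (snd p)) \<in> borel \<rightarrow>\<^sub>M borel"
    unfolding weighted_scale_def by (intro borel_measurable_continuous_onI continuous_intros)
  then have joint[measurable]:
    "(\<lambda>p. ?R (fst p) (snd p)) \<in> borel \<Otimes>\<^sub>M borel \<rightarrow>\<^sub>M borel"
    by (simp add: borel_prod)
  have Fint: "integrable (lborel \<Otimes>\<^sub>M lborel) (case_prod F)"
  proof (rule lborel_pair.Fubini_integrable)
    show "case_prod F \<in> borel_measurable (lborel \<Otimes>\<^sub>M lborel)"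
      unfolding F_def case_prod_beta by measurable
    have "(\<lambda>\<theta>. LINT x|lborel. norm (case_prod F (\<theta>, x)))
        = (\<lambda>\<theta>. indicator ?I \<theta> * (LINT x|lborel. norm (h x)))"
      using integral_compose_orthogonal[OF R integrable_norm[OF hint]] by (simp add: F_def fun_eq_iff)
    then show "integrable lborel (\<lambda>\<theta>. LINT x|lborel. norm (case_prod F (\<theta>, x)))"
      by simp
    show "AE \<theta> in lborel. integrable lborel (\<lambda>x. case_prod F (\<theta>, x))"
      unfolding F_def using integrable_compose_orthogonal[OF R hint] by simp
  qed
  have circle: "(LINT \<theta>|lborel. F \<theta> x) = indicator D x *\<^sub>R (2 * pi * h 0)" for x
  proof (cases "x \<in> D")
    case True
    then show ?thesis
      using mean_value_unit_circle[OF holomorphic_on_weighted_disc[OF D(1) h(1) True]]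
      by (simp add: F_def set_lebesgue_integral_def weighted_scale_0[OF D(1)])
  next
    case False
    \<comment> \<open>a rotation can be undone inside \<open>D\<close>, so it does not lead from outside into \<open>D\<close>\<close>
    have "?R \<theta> x \<notin> D" for \<theta>
    proof
      assume "?R \<theta> x \<in> D"
      then have "weighted_scale m (cis (- \<theta>)) (?R \<theta> x) \<in> D"
        using D(1) by (simp add: quasi_balanced_def)
      moreover have "weighted_scale m (cis (- \<theta>)) (?R \<theta> x) = x"
        by (simp add: weighted_scale_def vec_eq_iff mult.assoc[symmetric]
            power_mult_distrib[symmetric] cis_mult)
      ultimately show False using False by simp
    qed
    then show ?thesis using False h(2) by (simp add: F_def)
  qed
  have "2 * pi * integral\<^sup>L lborel h = (LINT \<theta>|lborel. LINT x|lborel. F \<theta> x)"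
    using integral_compose_orthogonal[OF R hint] by (simp add: F_def scaleR_conv_of_real)
  also have "\<dots> = (LINT x|lborel. LINT \<theta>|lborel. F \<theta> x)"
    using lborel_pair.Fubini_integral[OF Fint] by simp
  also have "\<dots> = measure lborel D * (2 * pi * h 0)"
    using D(2,3) by (simp add: circle fmeasurable_def scaleR_conv_of_real)
  finally have "integral\<^sup>L lborel h = measure lborel D * h 0"
    by simp
  then show ?thesis
    using integral_lebesgue_on_eq_lborel[of D h] D(2) hm h(2) by simp
qed


section \<open>The Bergman space and its projection\<close>

lemma L2_space_mult_integrable:
  assumes "f \<in> L2_space D" "g \<in> L2_space D"
  shows "integrable (lebesgue_on D) (\<lambda>x. f x * g x)"
proof (rule Bochner_Integration.integrable_bound)
  show "integrable (lebesgue_on D) (\<lambda>x. (norm (f x))\<^sup>2 + (norm (g x))\<^sup>2)"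
    using assms by (auto simp: L2_space_def)
  show "(\<lambda>x. f x * g x) \<in> borel_measurable (lebesgue_on D)"
    using assms by (auto simp: L2_space_def)
  have "norm (f x * g x) \<le> norm ((norm (f x))\<^sup>2 + (norm (g x))\<^sup>2)" for x
  proof -
    have nonneg: "0 \<le> norm (f x) * norm (g x)"
      by simp
    have "2 * (norm (f x) * norm (g x)) \<le> (norm (f x))\<^sup>2 + (norm (g x))\<^sup>2"
      using sum_squares_bound[of "norm (f x)" "norm (g x)"] by (simp add: mult.assoc)
    then have "norm (f x) * norm (g x) \<le> (norm (f x))\<^sup>2 + (norm (g x))\<^sup>2"
      using nonneg by linarith
    then show ?thesis
      by (simp add: norm_mult)
  qed
  then show "AE x in lebesgue_on D. norm (f x * g x) \<le> norm ((norm (f x))\<^sup>2 + (norm (g x))\<^sup>2)"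
    by simp
qed

lemma L2_space_cnj: "f \<in> L2_space D \<Longrightarrow> (\<lambda>x. cnj (f x)) \<in> L2_space D"
  by (auto simp: L2_space_def
      intro: measurable_compose[OF _ borel_measurable_continuous_onI[OF continuous_on_cnj[OF continuous_on_id]]])

lemma L2_space_scale: "f \<in> L2_space D \<Longrightarrow> (\<lambda>x. c * f x) \<in> L2_space D"
  by (auto simp: L2_space_def norm_mult power_mult_distrib)

lemma L2_space_diff:
  assumes "f \<in> L2_space D" "g \<in> L2_space D"
  shows "(\<lambda>x. f x - g x) \<in> L2_space D"
proof -
  have [measurable]: "f \<in> borel_measurable (lebesgue_on D)" "g \<in> borel_measurable (lebesgue_on D)"
    using assms by (auto simp: L2_space_def)
  have "integrable (lebesgue_on D) (\<lambda>x. (norm (f x - g x))\<^sup>2)"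
  proof (rule Bochner_Integration.integrable_bound)
    show "integrable (lebesgue_on D) (\<lambda>x. 2 * (norm (f x))\<^sup>2 + 2 * (norm (g x))\<^sup>2)"
      using assms by (auto simp: L2_space_def)
    have "norm ((norm (f x - g x))\<^sup>2) \<le> norm (2 * (norm (f x))\<^sup>2 + 2 * (norm (g x))\<^sup>2)" for x
    proof -
      have "(norm (f x - g x))\<^sup>2 \<le> (norm (f x) + norm (g x))\<^sup>2"
        by (intro power_mono norm_triangle_ineq4) simp
      also have "\<dots> \<le> 2 * (norm (f x))\<^sup>2 + 2 * (norm (g x))\<^sup>2"
        using sum_squares_bound[of "norm (f x)" "norm (g x)"] by (simp add: power2_sum)
      finally show ?thesis by simp
    qed
    then show "AE x in lebesgue_on D.
        norm ((norm (f x - g x))\<^sup>2) \<le> norm (2 * (norm (f x))\<^sup>2 + 2 * (norm (g x))\<^sup>2)"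
      by simp
  qed measurable
  then show ?thesis
    by (simp add: L2_space_def)
qed

lemma holomorphic_several_diff:
  assumes "holomorphic_several D f" "holomorphic_several D g"
  shows "holomorphic_several D (\<lambda>x. f x - g x)"
  unfolding holomorphic_several_def
proof
  fix x assume "x \<in> D"
  then obtain a b where
    a: "(f has_derivative (\<lambda>h. \<Sum>i\<in>UNIV. a $ i * h $ i)) (at x)" and
    b: "(g has_derivative (\<lambda>h. \<Sum>i\<in>UNIV. b $ i * h $ i)) (at x)"
    using assms unfolding holomorphic_several_def by blast
  from has_derivative_diff[OF a b]
  show "\<exists>c. ((\<lambda>x. f x - g x) has_derivative (\<lambda>h. \<Sum>i\<in>UNIV. c $ i * h $ i)) (at x)"
    by (intro exI[of _ "a - b"]) (simp add: left_diff_distrib sum_subtractf)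
qed

lemma holomorphic_several_mult:
  assumes "holomorphic_several D f" "holomorphic_several D g"
  shows "holomorphic_several D (\<lambda>x. f x * g x)"
  unfolding holomorphic_several_def
proof
  fix x assume "x \<in> D"
  then obtain a b where
    a: "(f has_derivative (\<lambda>h. \<Sum>i\<in>UNIV. a $ i * h $ i)) (at x)" and
    b: "(g has_derivative (\<lambda>h. \<Sum>i\<in>UNIV. b $ i * h $ i)) (at x)"
    using assms unfolding holomorphic_several_def by blast
  from has_derivative_mult[OF a b]
  show "\<exists>c. ((\<lambda>x. f x * g x) has_derivative (\<lambda>h. \<Sum>i\<in>UNIV. c $ i * h $ i)) (at x)"
    by (intro exI[of _ "\<chi> i. f x * b $ i + a $ i * g x"])
      (simp add: algebra_simps sum.distrib sum_distrib_left)
qed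

lemma holomorphic_several_const: "holomorphic_several D (\<lambda>x. c)"
  unfolding holomorphic_several_def by (auto intro!: exI[of _ 0])

lemma holomorphic_several_cong:
  assumes D: "open D" and f: "holomorphic_several D f" and eq: "\<And>x. x \<in> D \<Longrightarrow> f x = g x"
  shows "holomorphic_several D g"
  unfolding holomorphic_several_def
proof
  fix x assume x: "x \<in> D"
  then obtain a where "(f has_derivative (\<lambda>h. \<Sum>i\<in>UNIV. a $ i * h $ i)) (at x)"
    using f unfolding holomorphic_several_def by blast
  then have "(g has_derivative (\<lambda>h. \<Sum>i\<in>UNIV. a $ i * h $ i)) (at x)"
    using has_derivative_transform_within_open[OF _ D x] eq by blast
  then show "\<exists>a. (g has_derivative (\<lambda>h. \<Sum>i\<in>UNIV. a $ i * h $ i)) (at x)" ..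
qed

lemma bergman_space_diff:
  "f \<in> bergman_space D \<Longrightarrow> g \<in> bergman_space D \<Longrightarrow> (\<lambda>x. f x - g x) \<in> bergman_space D"
  by (simp add: bergman_space_def L2_space_diff holomorphic_several_diff)

lemma bergman_space_scale_fun:
  "f \<in> bergman_space D \<Longrightarrow> scale_fun c f \<in> bergman_space D"
  unfolding scale_fun_def
  by (simp add: bergman_space_def L2_space_scale
      holomorphic_several_mult[OF holomorphic_several_const])

lemma indicator_in_bergman_space:
  assumes "open D" "D \<in> lmeasurable"
  shows "indicator D \<in> bergman_space D"
proof -
  have D: "D \<inter> space lebesgue \<in> sets lebesgue"
    using assms(1) by auto
  have eq: "(\<lambda>x. indicat_real D x * (cmod (indicator D x))\<^sup>2) = indicat_real D"
    by (auto simp: fun_eq_iff indicator_def)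
  have meas: "(indicator D :: _ \<Rightarrow> complex) \<in> borel_measurable lebesgue"
    using assms(1) by (intro borel_measurable_indicator) auto
  have "integrable (lebesgue_on D) (\<lambda>x. (cmod (indicator D x))\<^sup>2)"
    using assms by (simp add: integrable_restrict_space[OF D] eq fmeasurable_def)
  moreover have "holomorphic_several D (indicator D)"
    by (rule holomorphic_several_cong[OF assms(1) holomorphic_several_const[of D 1]]) simp
  ultimately show ?thesis
    using measurable_restrict_space1[OF meas] by (simp add: bergman_space_def L2_space_def)
qed

text \<open>
  A holomorphic function of norm zero vanishes almost everywhere, and its set of nonzeros in \<open>D\<close> is
  open; a null open set is empty.
\<close>
lemma bergman_space_eq_0:
  assumes D: "open D" and k: "k \<in> bergman_space D" and 0: "L2_inner D k k = 0"
  shows "k x = 0"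
proof -
  have int: "integrable (lebesgue_on D) (\<lambda>x. (norm (k x))\<^sup>2)"
    using k by (simp add: bergman_space_def L2_space_def)
  have "(\<lambda>x. k x * cnj (k x)) = (\<lambda>x. of_real ((norm (k x))\<^sup>2))"
    by (simp only: complex_norm_square)
  with 0 have "complex_of_real (LINT x|lebesgue_on D. (norm (k x))\<^sup>2) = 0"
    unfolding L2_inner_def by (simp only: integral_complex_of_real)
  then have "AE x in lebesgue_on D. (norm (k x))\<^sup>2 = 0"
    using integral_nonneg_eq_0_iff_AE[OF int] by simp
  then have AE: "AE x\<in>D in lebesgue. k x = 0"
    using D by (simp add: AE_restrict_space_iff)
  let ?N = "{x \<in> D. k x \<noteq> 0}"
  have "?N = D \<inter> k -` (- {0})"
    by auto
  moreover have "open (D \<inter> k -` (- {0}))"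
    using k D holomorphic_several_imp_continuous_on
    by (intro continuous_open_preimage) (auto simp: bergman_space_def)
  ultimately have "open ?N" by simp
  moreover have "negligible ?N"
  proof -
    have "?N \<in> null_sets lebesgue"
      using AE \<open>open ?N\<close> by (subst AE_iff_null_sets) auto
    then show ?thesis by (simp add: negligible_iff_null_sets)
  qed
  ultimately have "?N = {}"
    using open_not_negligible by blast
  with k show ?thesis
    by (cases "x \<in> D") (auto simp: bergman_space_def)
qed

text \<open>
  Two candidates for the projection differ by a function that is both in the Bergman space and
  orthogonal to it, hence zero. So the definite description is settled by exhibiting one candidate.
\<close>
lemma bergman_projection_eqI:
  assumes D: "open D" and f: "f \<in> L2_space D" and h: "h \<in> bergman_space D"
    and orth: "\<And>g. g \<in> bergman_space D \<Longrightarrow> L2_inner D (\<lambda>x. f x - h x) g = 0"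
  shows "bergman_projection D f = h"
  unfolding bergman_projection_def
proof (rule the_equality)
  show "h \<in> bergman_space D \<and> (\<forall>g\<in>bergman_space D. L2_inner D (\<lambda>x. f x - h x) g = 0)"
    using h orth by blast
next
  fix h' assume h': "h' \<in> bergman_space D \<and> (\<forall>g\<in>bergman_space D. L2_inner D (\<lambda>x. f x - h' x) g = 0)"
  let ?k = "\<lambda>x. h' x - h x"
  have k: "?k \<in> bergman_space D"
    using h h' by (simp add: bergman_space_diff)
  have L2: "h \<in> L2_space D" "h' \<in> L2_space D" "?k \<in> L2_space D"
    using h h' k by (auto simp: bergman_space_def)
  have int: "integrable (lebesgue_on D) (\<lambda>x. (f x - u x) * cnj (?k x))" if "u \<in> L2_space D" for u
    using that L2_space_mult_integrable[OF L2_space_diff[OF f that] L2_space_cnj[OF L2(3)]] by simp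
  have "L2_inner D ?k ?k = (LINT x|lebesgue_on D. (f x - h x) * cnj (?k x) - (f x - h' x) * cnj (?k x))"
    unfolding L2_inner_def by (simp add: algebra_simps)
  also have "\<dots> = L2_inner D (\<lambda>x. f x - h x) ?k - L2_inner D (\<lambda>x. f x - h' x) ?k"
    unfolding L2_inner_def by (rule Bochner_Integration.integral_diff[OF int[OF L2(1)] int[OF L2(2)]])
  also have "\<dots> = 0"
    using orth[OF k] h' k by simp
  finally have "h' x - h x = 0" for x
    by (rule bergman_space_eq_0[OF D k])
  then show "h' = h"
    by (intro ext) (simp only: right_minus_eq)
qed

section \<open>The Friedrichs operator of a quasi-balanced set\<close>

text \<open>
  For \<open>k\<close> in the Bergman space, \<open>(g - g(0)) k\<close> is holomorphic, integrable and zero at the origin, so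
  its integral vanishes; the conjugate of that integral is the inner product of \<open>cnj g - cnj (g(0))\<close>
  with \<open>k\<close>.
\<close>
lemma friedrichs_operator_quasi_balanced:
  assumes D: "quasi_balanced m D" "open D" "D \<in> lmeasurable" and g: "g \<in> bergman_space D"
  shows "friedrichs_operator D g = scale_fun (cnj (g 0)) (indicator D)"
  unfolding friedrichs_operator_def
proof (rule bergman_projection_eqI[OF D(2)])
  show "(\<lambda>x. cnj (g x)) \<in> L2_space D"
    using g by (simp add: bergman_space_def L2_space_cnj)
  have ind: "indicator D \<in> bergman_space D"
    by (rule indicator_in_bergman_space[OF D(2,3)])
  then show "scale_fun (cnj (g 0)) (indicator D) \<in> bergman_space D"
    by (rule bergman_space_scale_fun)
  fix k assume k: "k \<in> bergman_space D"
  let ?u = "\<lambda>x. g x - scale_fun (g 0) (indicator D) x"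
  have u: "?u \<in> bergman_space D"
    by (intro bergman_space_diff bergman_space_scale_fun g ind)
  have int: "integrable (lebesgue_on D) (\<lambda>x. ?u x * k x)"
    using u k by (intro L2_space_mult_integrable) (auto simp: bergman_space_def)
  \<comment> \<open>either \<open>0 \<in> D\<close> and the first factor vanishes, or \<open>k\<close> is zero at the origin by convention\<close>
  have u0: "?u 0 * k 0 = 0"
    using k by (cases "0 \<in> D") (auto simp: scale_fun_def bergman_space_def)
  have "L2_inner D (\<lambda>x. cnj (g x) - scale_fun (cnj (g 0)) (indicator D) x) k
      = (LINT x|lebesgue_on D. cnj (?u x * k x))"
    unfolding L2_inner_def
    by (intro Bochner_Integration.integral_cong) (auto simp: scale_fun_def indicator_def)
  also have "\<dots> = cnj (LINT x|lebesgue_on D. ?u x * k x)"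
    by (rule integral_bounded_linear[OF bounded_linear_cnj int])
  also have "(LINT x|lebesgue_on D. ?u x * k x) = measure lebesgue D * (?u 0 * k 0)"
    using u k by (intro integral_quasi_balanced[OF D _ _ int])
      (auto simp: bergman_space_def intro!: holomorphic_several_mult)
  finally show "L2_inner D (\<lambda>x. cnj (g x) - scale_fun (cnj (g 0)) (indicator D) x) k = 0"
    using u0 by simp
qed

theorem friedrichs_rank_one_quasi_balanced:
  assumes D: "quasi_balanced m D" "open D" "D \<in> lmeasurable" "D \<noteq> {}"
  shows "friedrichs_rank_one D"
proof -
  interpret vector_space "scale_fun :: complex \<Rightarrow> (complex ^ 'a \<Rightarrow> complex) \<Rightarrow> _"
    by (rule vector_space_scale_fun)
  let ?e = "indicator D :: complex ^ 'a \<Rightarrow> complex"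
  obtain x where "x \<in> D"
    using D(4) by blast
  then have "weighted_scale m 0 x \<in> D"
    using D(1) by (simp add: quasi_balanced_def)
  then have 0: "0 \<in> D"
    by (simp add: weighted_scale_0[OF D(1)])
  have e: "?e \<in> bergman_space D"
    by (rule indicator_in_bergman_space[OF D(2,3)])
  have "friedrichs_operator D ` bergman_space D = range (\<lambda>c. scale_fun c ?e)"
  proof (intro equalityI subsetI)
    fix u assume "u \<in> friedrichs_operator D ` bergman_space D"
    then show "u \<in> range (\<lambda>c. scale_fun c ?e)"
      using friedrichs_operator_quasi_balanced[OF D(1-3)] by auto
  next
    fix u assume "u \<in> range (\<lambda>c. scale_fun c ?e)"
    then obtain c where "u = scale_fun c ?e" by blast
    also have "\<dots> = friedrichs_operator D (scale_fun (cnj c) ?e)"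
      using 0 by (subst friedrichs_operator_quasi_balanced[OF D(1-3) bergman_space_scale_fun[OF e]])
        (simp add: scale_fun_def)
    finally show "u \<in> friedrichs_operator D ` bergman_space D"
      using bergman_space_scale_fun[OF e] by blast
  qed
  then have range: "friedrichs_operator D ` bergman_space D = span {?e}"
    by (simp add: span_singleton)
  have "?e \<noteq> 0"
  proof
    assume "?e = 0"
    then have "?e 0 = 0"
      by (simp only: zero_fun_apply)
    with 0 show False
      by simp
  qed
  then have "independent {?e}"
    by (simp add: independent_insert)
  from dim_span_eq_card_independent[OF this] have "dim (span {?e}) = 1"
    by simp
  then show ?thesis
    unfolding friedrichs_rank_one_def range by (simp add: subspace_span)
qed

section \<open>The tetrablock\<close>

text \<open>
  The complement is the projection of a closed set along the compact bidisc.
\<close>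
lemma open_tetrablock: "open tetrablock"
proof -
  define T where "T = {((z, w), x :: complex ^ 3) | z w x.
      1 - z * x $ 1 - w * x $ 2 + z * w * x $ 3 = 0}"
  have "T = {p. 1 - fst (fst p) * snd p $ 1 - snd (fst p) * snd p $ 2
      + fst (fst p) * snd (fst p) * snd p $ 3 = 0}"
    by (auto simp: T_def)
  then have "closed T"
    by (simp only:) (intro closed_Collect_eq continuous_intros)
  then have "closed {x. \<exists>p. p \<in> cball 0 1 \<times> cball 0 1 \<and> (p, x) \<in> T}"
    by (intro closed_compact_projection compact_Times compact_cball)
  also have "{x. \<exists>p. p \<in> cball 0 1 \<times> cball 0 1 \<and> (p, x) \<in> T} = - tetrablock"
    by (auto simp: T_def tetrablock_def)
  finally show ?thesis
    by (simp add: closed_open)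
qed

text \<open>
  If \<open>\<bar>a\<bar> \<le> \<bar>b\<bar>\<close> then either \<open>z = a / b\<close> is a zero in the closed disc, or \<open>a = b = 0\<close> and every \<open>z\<close> is.
\<close>
lemma norm_less_if_no_zero_in_disc:
  fixes a b :: complex
  assumes "\<And>z. norm z \<le> 1 \<Longrightarrow> a - z * b \<noteq> 0"
  shows "norm b < norm a"
proof (rule ccontr)
  assume "\<not> norm b < norm a"
  moreover have "a \<noteq> 0"
    using assms[of 0] by simp
  ultimately have "b \<noteq> 0" "norm (a / b) \<le> 1"
    by (auto simp: norm_divide divide_le_eq)
  then show False
    using assms[of "a / b"] by simp
qed

lemma tetrablockD:
  assumes "x \<in> tetrablock" "norm z \<le> 1" "norm w \<le> 1"
  shows "1 - z * x $ 1 - w * x $ 2 + z * w * x $ 3 \<noteq> 0"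
  using assms by (simp add: tetrablock_def)

text \<open>
  Fixing one of the two disc variables leaves an affine function of the other without zeros in the
  closed disc. The values \<open>w = 0\<close> and \<open>z = 0\<close> bound the first two coordinates by 1, and \<open>w = 1\<close> gives
  \<open>\<bar>x\<^sub>1 - x\<^sub>3\<bar> < \<bar>1 - x\<^sub>2\<bar> < 2\<close>, hence \<open>\<bar>x\<^sub>3\<bar> < 3\<close>.
\<close>
lemma bounded_tetrablock: "bounded tetrablock"
proof (rule boundedI)
  fix x assume x: "x \<in> tetrablock"
  have x1: "norm (x $ 1) < 1"
    using norm_less_if_no_zero_in_disc[of 1 "x $ 1"] tetrablockD[OF x, of _ 0] by simp
  have x2: "norm (x $ 2) < 1"
    using norm_less_if_no_zero_in_disc[of 1 "x $ 2"] tetrablockD[OF x, of 0] by simp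
  have "(1 - x $ 2) - z * (x $ 1 - x $ 3) \<noteq> 0" if "norm z \<le> 1" for z
  proof -
    have "1 - z * x $ 1 - 1 * x $ 2 + z * 1 * x $ 3 \<noteq> 0"
      by (rule tetrablockD[OF x that]) simp
    then show ?thesis by (simp add: algebra_simps)
  qed
  then have "norm (x $ 1 - x $ 3) < norm (1 - x $ 2)"
    by (rule norm_less_if_no_zero_in_disc)
  moreover have "norm (1 - x $ 2) \<le> 1 + norm (x $ 2)"
    using norm_triangle_ineq4[of 1 "x $ 2"] by simp
  moreover have "norm (x $ 3) \<le> norm (x $ 1) + norm (x $ 1 - x $ 3)"
    using norm_triangle_ineq4[of "x $ 1" "x $ 1 - x $ 3"] by simp
  ultimately have x3: "norm (x $ 3) < 3"
    using x1 x2 by linarith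
  have "norm x \<le> (\<Sum>i\<in>UNIV. norm (x $ i))"
    unfolding norm_vec_def by (rule L2_set_le_sum) simp
  also have "\<dots> \<le> 5"
    unfolding sum_3 using x1 x2 x3 by linarith
  finally show "norm x \<le> 5" .
qed

lemma quasi_balanced_tetrablock: "quasi_balanced (\<lambda>i. if i = 3 then 2 else 1) tetrablock"
  unfolding quasi_balanced_def
proof (intro conjI allI ballI)
  fix x t assume x: "x \<in> tetrablock" and t: "t \<in> cball (0::complex) 1"
  let ?y = "weighted_scale (\<lambda>i. if i = 3 then 2 else 1) t x"
  show "?y \<in> tetrablock"
    unfolding tetrablock_def
  proof (intro CollectI ballI)
    fix z w :: complex assume "z \<in> cball 0 1" "w \<in> cball 0 1"
    with t have "z * t \<in> cball 0 1" "w * t \<in> cball 0 1"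
      by (auto simp: norm_mult intro: mult_le_one)
    then have "1 - (z * t) * x $ 1 - (w * t) * x $ 2 + (z * t) * (w * t) * x $ 3 \<noteq> 0"
      by (intro tetrablockD[OF x]) auto
    then show "1 - z * ?y $ 1 - w * ?y $ 2 + z * w * ?y $ 3 \<noteq> 0"
      by (simp add: weighted_scale_def power2_eq_square mult_ac)
  qed
qed simp

theorem theorem4p2: "friedrichs_rank_one tetrablock"
proof (rule friedrichs_rank_one_quasi_balanced)
  show "quasi_balanced (\<lambda>i. if i = 3 then 2 else 1) tetrablock"
    by (rule quasi_balanced_tetrablock)
  show "open tetrablock" "tetrablock \<in> lmeasurable"
    using open_tetrablock bounded_tetrablock by (auto intro: lmeasurable_open)
  show "tetrablock \<noteq> {}"
    by (auto simp: tetrablock_def intro!: exI[of _ 0])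
qed

end
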